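(* Let $(M,d)$ be a metric space and let $\tau$ be a topology on the set $M$ (not assumed to be related to the metric topology of $d$). Let $f,g:M\to\mathbb{R}$ be two $\tau$-continuous and $\tau$-coercive functions such that: (i) $|\nabla f|(x)=|\nabla g|(x)<+\infty$ for every $x\in M$; (ii) there exists $c\in\mathbb{R}$ such that $g(x)-f(x)=c$ for all $x\in\mathrm{Crit}(f)$. Then $g=f+c$ on $M$.
   Context: Let $(M,d)$ be a metric space. The metric slope of $f:M\to\mathbb{R}$ at $x\in M$ is the element $|\nabla f|(x)\in[0,+\infty]$ defined by $|\nabla f|(x)=0$ if $x$ is an isolated point of $(M,d)$, and otherwise $$|\nabla f|(x)=\limsup_{y\to x}\frac{(f(x)-f(y))^{+}}{d(x,y)},$$ where the limsup is over $y\neq x$ converging to $x$ in the metric $d$, and $t^{+}=\max\{t,0\}$. The set of (metric) critical points of $f$ is $\mathrm{Crit}(f)=\{x\in M: |\nabla f|(x)=0\}$. For $\alpha\in\mathbb{R}$, $[f\le\alpha]=\{x\in M: f(x)\le\alpha\}$. Given a topology $\tau$ on $M$ (which may be stronger than, weaker than, or not comparable to the metric topology), $f$ is called $\tau$-coercive if $[f\le\alpha]$ is $\tau$-compact for every real $\alpha<\sup_{x\in M}f(x)$ (the supremum may be $+\infty$). Here compactness means that every open cover has a finite subcover (no Hausdorff assumption). $\tau$-continuity means continuity with respect to $\tau$ on $M$ and the usual topology on $\mathbb{R}$. The slope is always computed with respect to $d$. *)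

theory Defs
  imports "HOL-Analysis.Analysis"
begin

text \<open>The case distinction is needed because at an isolated point the filter is trivial
  and the \<open>Limsup\<close> would be \<open>-\<infinity>\<close>.\<close>

definition metric_slope :: "'a set \<Rightarrow> ('a \<Rightarrow> 'a \<Rightarrow> real) \<Rightarrow> ('a \<Rightarrow> real) \<Rightarrow> 'a \<Rightarrow> ereal" where
  "metric_slope M d f x =
    (if openin (Metric_space.mtopology M d) {x} then 0
     else Limsup (atin (Metric_space.mtopology M d) x)
            (\<lambda>y. ereal (max (f x - f y) 0 / d x y)))"

definition metric_crit :: "'a set \<Rightarrow> ('a \<Rightarrow> 'a \<Rightarrow> real) \<Rightarrow> ('a \<Rightarrow> real) \<Rightarrow> 'a set" where
  "metric_crit M d f = {x \<in> M. metric_slope M d f x = 0}"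

text \<open>The supremum is taken in the extended reals, as \<open>f\<close> may be unbounded above.\<close>

definition coercive_on_topology :: "'a topology \<Rightarrow> ('a \<Rightarrow> real) \<Rightarrow> bool" where
  "coercive_on_topology \<tau> f \<longleftrightarrow>
    (\<forall>\<alpha>::real. ereal \<alpha> < (SUP x\<in>topspace \<tau>. ereal (f x)) \<longrightarrow>
       compactin \<tau> {x \<in> topspace \<tau>. f x \<le> \<alpha>})"

end

theory Submission
  imports Defs
begin

text \<open>For \<open>\<epsilon> > 0\<close>, at every noncritical point of \<open>f\<close> the function \<open>(1 + \<epsilon>) f\<close> has a strictly larger
  slope than \<open>g\<close>, so some move strictly decreases both \<open>f\<close> and \<open>(1 + \<epsilon>) f - g\<close>. Hence the minimum
  of \<open>(1 + \<epsilon>) f - g\<close> over a compact sublevel set of \<open>f\<close> is attained at a critical point, where it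
  equals \<open>\<epsilon> f - c\<close>. Since \<open>f\<close> is bounded below, letting \<open>\<epsilon>\<close> tend to 0 gives \<open>g \<le> f + c\<close>; the
  reverse inequality follows by symmetry.\<close>

text \<open>At a non-isolated point the punctured-neighbourhood filter is nontrivial, so a
  \<open>Limsup\<close> of nonnegative quotients cannot drop below 0.\<close>

lemma metric_slope_nonneg:
  assumes "Metric_space M d" "x \<in> M"
  shows "0 \<le> metric_slope M d f x"
proof (cases "openin (Metric_space.mtopology M d) {x}")
  case True
  then show ?thesis by (simp add: metric_slope_def)
next
  case False
  interpret Metric_space M d by fact
  have "\<not> eventually (\<lambda>_. False) (atin mtopology x)"
  proof
    assume "eventually (\<lambda>_. False) (atin mtopology x)"
    then obtain U where U: "openin mtopology U" "x \<in> U" "U - {x} = {}"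
      using assms(2) by (auto simp: eventually_atin)
    then have "U = {x}" by auto
    with U(1) False show False by simp
  qed
  then have "atin mtopology x \<noteq> bot"
    by (simp add: trivial_limit_def)
  then have "0 \<le> Limsup (atin mtopology x) (\<lambda>y. ereal (max (f x - f y) 0 / d x y))"
    by (intro le_Limsup always_eventually) auto
  with False show ?thesis by (simp add: metric_slope_def)
qed

text \<open>The common slope \<open>s\<close> is positive and finite, so there are
  \<open>a < s < b\<close> with \<open>b = (1 + e) * a\<close>. Near \<open>x\<close> the quotient
  of \<open>g\<close> stays below \<open>b\<close>, while that of \<open>f\<close> exceeds
  \<open>a\<close> at points arbitrarily close to \<open>x\<close>; any point with both properties
  will do.\<close>

lemma metric_slope_common_descent:
  assumes "Metric_space M d" "x \<in> M"
    and eq: "metric_slope M d f x = metric_slope M d g x"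
    and fin: "metric_slope M d f x < \<infinity>"
    and nz: "metric_slope M d f x \<noteq> 0"
    and "e > (0::real)"
  obtains y where "y \<in> M" "f y < f x" "(1 + e) * f y - g y < (1 + e) * f x - g x"
proof -
  interpret Metric_space M d by fact
  from metric_slope_nonneg[OF assms(1,2), of f] nz fin
  obtain s where s: "metric_slope M d f x = ereal s" "s > 0"
    by (cases "metric_slope M d f x") auto
  have niso: "\<not> openin mtopology {x}"
    using nz by (auto simp: metric_slope_def)
  \<comment> \<open>Any \<open>b\<close> strictly between \<open>s\<close> and
    \<open>(1 + e) * s\<close> would serve: it puts \<open>a = b / (1 + e)\<close> below
    \<open>s\<close>.\<close>
  define b where "b = s * (1 + e / 2)"
  define a where "a = b / (1 + e)"
  have b: "s < b" "b = (1 + e) * a"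
    using s(2) \<open>e > 0\<close> by (auto simp: a_def b_def)
  have "b < (1 + e) * s"
    using s(2) \<open>e > 0\<close> by (simp add: b_def algebra_simps)
  then have a: "0 < a" "a < s"
    using s(2) b(1) \<open>e > 0\<close> by (auto simp: a_def field_simps)
  have Lf: "Limsup (atin mtopology x) (\<lambda>y. ereal (max (f x - f y) 0 / d x y)) = s"
    and Lg: "Limsup (atin mtopology x) (\<lambda>y. ereal (max (g x - g y) 0 / d x y)) = s"
    using niso s(1) eq by (auto simp: metric_slope_def)
  have evg: "eventually (\<lambda>y. ereal (max (g x - g y) 0 / d x y) < b) (atin mtopology x)"
    using Lg b(1) by (intro Limsup_lessD) auto
  have evM: "eventually (\<lambda>y. y \<in> M \<and> y \<noteq> x) (atin mtopology x)"
    using openin_topspace[of mtopology] assms(2)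
    by (auto simp: eventually_atin intro!: exI[of _ M])
  have "\<not> eventually (\<lambda>y. ereal (max (f x - f y) 0 / d x y) \<le> a) (atin mtopology x)"
  proof
    assume "eventually (\<lambda>y. ereal (max (f x - f y) 0 / d x y) \<le> a) (atin mtopology x)"
    from Limsup_bounded[OF this] Lf a(2) show False by simp
  qed
  then have "frequently (\<lambda>y. \<not> ereal (max (f x - f y) 0 / d x y) \<le> a) (atin mtopology x)"
    by (simp add: frequently_def)
  from frequently_ex[OF frequently_eventually_frequently[OF this eventually_conj[OF evg evM]]]
  obtain y where y:
    "y \<in> M" "y \<noteq> x" "max (g x - g y) 0 / d x y < b" "\<not> max (f x - f y) 0 / d x y \<le> a"
    by auto
  have d: "d x y > 0" using y assms(2) by auto
  then have fg: "a * d x y < max (f x - f y) 0" "max (g x - g y) 0 < b * d x y"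
    using y(3,4) by (simp_all only: not_le pos_less_divide_eq pos_divide_less_eq)
  \<comment> \<open>Positivity of \<open>a\<close> forces the positive part of
    \<open>f x - f y\<close> to be the difference itself, so \<open>f\<close> really
    decreases.\<close>
  have "0 < a * d x y" using a d by simp
  then have f: "a * d x y < f x - f y" "f y < f x" using fg(1) by auto
  have "g x - g y < (1 + e) * (a * d x y)"
    using fg(2) b(2) by simp
  also have "\<dots> < (1 + e) * (f x - f y)"
    using f(1) \<open>e > 0\<close> by simp
  finally show thesis
    using that[OF y(1) f(2)] by (simp add: algebra_simps)
qed

text \<open>If \<open>f\<close> is not constant, some value \<open>f y\<close> lies below the
  supremum; the minimum of \<open>f\<close> over the compact set where \<open>f\<close> is at most
  \<open>f y\<close> is then global. Constant \<open>f\<close> is treated apart, since no sublevel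
  set below its supremum contains a point.\<close>

lemma coercive_bounded_below:
  assumes "continuous_map \<tau> euclideanreal f" "coercive_on_topology \<tau> f"
  obtains m :: real where "\<And>x. x \<in> topspace \<tau> \<Longrightarrow> m \<le> f x"
proof (cases "\<exists>y\<in>topspace \<tau>. \<exists>z\<in>topspace \<tau>. f y < f z")
  case False
  then have "\<forall>x\<in>topspace \<tau>. \<forall>y\<in>topspace \<tau>. f x \<le> f y" by force
  then show thesis using that by (cases "topspace \<tau> = {}") (simp_all, blast)
next
  case True
  then obtain y z where yz: "y \<in> topspace \<tau>" "z \<in> topspace \<tau>" "f y < f z" by blast
  let ?K = "{x \<in> topspace \<tau>. f x \<le> f y}"
  have "ereal (f y) < (SUP x\<in>topspace \<tau>. ereal (f x))"
    using yz(2,3) by (auto simp: less_SUP_iff)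
  then have "compactin \<tau> ?K"
    using assms(2) by (auto simp: coercive_on_topology_def)
  then have "compact (f ` ?K)"
    using image_compactin[OF _ assms(1)] by auto
  moreover have "f ` ?K \<noteq> {}" using yz(1) by auto
  ultimately obtain t where t: "t \<in> f ` ?K" "\<And>u. u \<in> f ` ?K \<Longrightarrow> t \<le> u"
    using compact_attains_inf[of "f ` ?K"] by blast
  have "t \<le> f x" if "x \<in> topspace \<tau>" for x
  proof (cases "f x \<le> f y")
    case True
    then show ?thesis using t(2) that by blast
  next
    case False
    moreover have "t \<le> f y" using t(2) yz(1) by blast
    ultimately show ?thesis by simp
  qed
  then show thesis using that by blast
qed

lemma slope_determination_le:
  assumes "Metric_space M d" "topspace \<tau> = M"
    and cf: "continuous_map \<tau> euclideanreal f" and cg: "continuous_map \<tau> euclideanreal g"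
    and coer: "coercive_on_topology \<tau> f"
    and slope: "\<And>x. x \<in> M \<Longrightarrow> metric_slope M d f x = metric_slope M d g x \<and> metric_slope M d f x < \<infinity>"
    and crit: "\<And>x. x \<in> metric_crit M d f \<Longrightarrow> g x - f x = c"
    and "x \<in> M"
  shows "g x \<le> f x + c"
proof (cases "x \<in> metric_crit M d f")
  case True
  then show ?thesis using crit[of x] by simp
next
  case False
  obtain m where m: "\<And>z. z \<in> M \<Longrightarrow> m \<le> f z"
    using coercive_bounded_below[OF cf coer] assms(2) by blast
  have descent: "\<exists>z\<in>M. f z < f y \<and> (1 + e) * f z - g z < (1 + e) * f y - g y"
    if y: "y \<in> M" "y \<notin> metric_crit M d f" and e: "e > 0" for y e
  proof -
    have "metric_slope M d f y \<noteq> 0" using y by (simp add: metric_crit_def)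
    from metric_slope_common_descent[OF assms(1) y(1) _ _ this e] slope[OF y(1)]
    show ?thesis by blast
  qed
  have bound: "e * m - c < (1 + e) * f x - g x" if e: "e > 0" for e
  proof -
    let ?h = "\<lambda>z. (1 + e) * f z - g z"
    \<comment> \<open>Coercivity says nothing about the sublevel set at height \<open>sup f\<close>, which \<open>f x\<close> may equal,
      so one descent step is made first.\<close>
    obtain y where y: "y \<in> M" "f y < f x" "?h y < ?h x"
      using descent[OF \<open>x \<in> M\<close> False e] by blast
    let ?K = "{z \<in> topspace \<tau>. f z \<le> f y}"
    have "ereal (f y) < (SUP z\<in>topspace \<tau>. ereal (f z))"
      using \<open>x \<in> M\<close> y(2) assms(2) by (auto simp: less_SUP_iff)
    then have "compactin \<tau> ?K"
      using coer by (auto simp: coercive_on_topology_def)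
    moreover have "continuous_map \<tau> euclideanreal ?h"
      using cf cg by (intro continuous_intros)
    ultimately have "compact (?h ` ?K)"
      using image_compactin by fastforce
    moreover have "?h ` ?K \<noteq> {}" using y(1) assms(2) by auto
    ultimately obtain z where z: "z \<in> ?K" "\<And>u. u \<in> ?K \<Longrightarrow> ?h z \<le> ?h u"
      using compact_attains_inf[of "?h ` ?K"] by auto
    have zM: "z \<in> M" using z(1) assms(2) by simp
    \<comment> \<open>A descent step from \<open>z\<close> also lowers \<open>f\<close>, hence stays
      in \<open>?K\<close>, and would contradict minimality of \<open>?h z\<close>.\<close>
    have "z \<in> metric_crit M d f"
    proof (rule ccontr)
      assume "z \<notin> metric_crit M d f"
      from descent[OF zM this e] obtain w where "w \<in> M" "f w < f z" "?h w < ?h z" by blast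
      with z(2)[of w] z(1) assms(2) show False by auto
    qed
    from crit[OF this] have "?h z = e * f z - c" by (simp add: algebra_simps)
    moreover have "e * m \<le> e * f z" using m[OF zM] e by simp
    moreover have "?h z \<le> ?h y" using z(2)[of y] y(1) assms(2) by simp
    ultimately show ?thesis using y(3) by linarith
  qed
  have "g x - f x - c \<le> 0 + r" if "r > 0" for r
  proof -
    \<comment> \<open>Chosen so that the error \<open>e * (f x - m)\<close> is at most
      \<open>r\<close>; the added 1 keeps the denominator positive.\<close>
    define e where "e = r / (1 + \<bar>f x - m\<bar>)"
    have "e > 0" using that by (simp add: e_def)
    have "g x - f x - c < e * (f x - m)"
      using bound[OF \<open>e > 0\<close>] by (simp add: algebra_simps)
    also have "\<dots> \<le> e * (1 + \<bar>f x - m\<bar>)"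
      using \<open>e > 0\<close> by (intro mult_left_mono) auto
    also have "\<dots> = r" by (simp add: e_def add_nonneg_eq_0_iff)
    finally show ?thesis by simp
  qed
  then have "g x - f x - c \<le> 0" by (rule field_le_epsilon)
  then show ?thesis by simp
qed

theorem theorem2p4:
  fixes M :: "'a set" and d :: "'a \<Rightarrow> 'a \<Rightarrow> real" and \<tau> :: "'a topology"
    and f g :: "'a \<Rightarrow> real" and c :: real
  assumes "Metric_space M d"
    and "topspace \<tau> = M"
    and "continuous_map \<tau> euclideanreal f"
    and "continuous_map \<tau> euclideanreal g"
    and "coercive_on_topology \<tau> f"
    and "coercive_on_topology \<tau> g"
    and "\<And>x. x \<in> M \<Longrightarrow> metric_slope M d f x = metric_slope M d g x \<and> metric_slope M d f x < \<infinity>"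
    and "\<And>x. x \<in> metric_crit M d f \<Longrightarrow> g x - f x = c"
  shows "\<forall>x\<in>M. g x = f x + c"
proof
  fix x assume "x \<in> M"
  have "g x \<le> f x + c"
    using slope_determination_le[OF assms(1-5,7,8) \<open>x \<in> M\<close>] .
  \<comment> \<open>Equal slopes give \<open>f\<close> and \<open>g\<close> the same critical
    points, so the swapped pair satisfies the hypotheses with constant \<open>- c\<close>.\<close>
  moreover have "f y - g y = - c" if "y \<in> metric_crit M d g" for y
    using that assms(7)[of y] assms(8)[of y] by (auto simp: metric_crit_def)
  then have "f x \<le> g x + - c"
    using assms(7) \<open>x \<in> M\<close>
    by (intro slope_determination_le[OF assms(1,2,4,3,6)]) metis+
  ultimately show "g x = f x + c" by simp
qed

end
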